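(* Let $q>1$ be a real number, $g$ a positive integer, and let $\alpha_i,\beta_i\in\mathbb C$ ($1\le i\le g$) satisfy $\alpha_i\beta_i=q$, $\alpha_i+\beta_i\in\mathbb R$ and $|\alpha_i+\beta_i|\le q+1$ for all $i$. Let $a$ be a non-negative real number, $h\ge0$ an integer, and let $\gamma_j,\delta_j\in\mathbb C$ ($1\le j\le h$) satisfy $\gamma_j\delta_j=q$, $\gamma_j+\delta_j\in\mathbb R$ and $|\gamma_j+\delta_j|\le q+1$. Put $$C_1(s)=q^{as}(1+q^{-s})\,q^{-hs}\prod_{j=1}^h(1-\gamma_jq^{s-1/2})(1-\delta_jq^{s-1/2}),\qquad C_2(s)=C_1(1-s),$$ $$\widehat\zeta_2(s)=C_1(s)\frac{Y(2s)}{1-q^{1-s}}-C_2(s)\frac{q^{-s}\,Y(2s-1)}{1-q^{-s}},$$ where $$Y(s)=q^{(g-1)(s-1/2)}\,\frac{\prod_{i=1}^g(1-\alpha_iq^{-s})(1-\beta_iq^{-s})}{(1-q^{-s})(1-q^{1-s})}.$$ Then $\widehat\zeta_2(s)$ satisfies the Riemann hypothesis: every zero $s\in\mathbb C$ of the meromorphic function $\widehat\zeta_2$ has $\mathrm{Re}(s)=\frac12$.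
   Context: No further definitions are needed. The condition $C_2(s)=C_1(1-s)$ is equivalent to the functional equation $\widehat\zeta_2(1-s)=\widehat\zeta_2(s)$. *)

theory Defs
  imports "HOL-Complex_Analysis.Complex_Analysis"
begin

definition Y :: "real \<Rightarrow> nat \<Rightarrow> (nat \<Rightarrow> complex) \<Rightarrow> (nat \<Rightarrow> complex) \<Rightarrow> complex \<Rightarrow> complex" where
  "Y q g \<alpha> \<beta> s =
     of_real q powr ((of_nat g - 1) * (s - 1/2)) *
     (\<Prod>i=1..g. (1 - \<alpha> i * of_real q powr (- s)) * (1 - \<beta> i * of_real q powr (- s))) /
     ((1 - of_real q powr (- s)) * (1 - of_real q powr (1 - s)))"

definition C1 :: "real \<Rightarrow> real \<Rightarrow> nat \<Rightarrow> (nat \<Rightarrow> complex) \<Rightarrow> (nat \<Rightarrow> complex) \<Rightarrow> complex \<Rightarrow> complex" where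
  "C1 q a h \<gamma> \<delta> s =
     of_real q powr (of_real a * s) * (1 + of_real q powr (- s)) * of_real q powr (- of_nat h * s) *
     (\<Prod>j=1..h. (1 - \<gamma> j * of_real q powr (s - 1/2)) * (1 - \<delta> j * of_real q powr (s - 1/2)))"

definition C2 :: "real \<Rightarrow> real \<Rightarrow> nat \<Rightarrow> (nat \<Rightarrow> complex) \<Rightarrow> (nat \<Rightarrow> complex) \<Rightarrow> complex \<Rightarrow> complex" where
  "C2 q a h \<gamma> \<delta> s = C1 q a h \<gamma> \<delta> (1 - s)"

definition zeta2_hat ::
  "real \<Rightarrow> nat \<Rightarrow> (nat \<Rightarrow> complex) \<Rightarrow> (nat \<Rightarrow> complex) \<Rightarrow>
   real \<Rightarrow> nat \<Rightarrow> (nat \<Rightarrow> complex) \<Rightarrow> (nat \<Rightarrow> complex) \<Rightarrow> complex \<Rightarrow> complex" where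
  "zeta2_hat q g \<alpha> \<beta> a h \<gamma> \<delta> s =
     C1 q a h \<gamma> \<delta> s * (Y q g \<alpha> \<beta> (2 * s) / (1 - of_real q powr (1 - s))) -
     C2 q a h \<gamma> \<delta> s * (of_real q powr (- s) * Y q g \<alpha> \<beta> (2 * s - 1) / (1 - of_real q powr (- s)))"

(* At a point where a denominator vanishes, the pointwise value of zeta2_hat is an artefact of
   x / 0 = 0, and such a point may be a pole or a removable singularity (e.g. where q^(-s) = -1).
   Hence a zero of a meromorphic function is defined by its limit, not its pointwise value.
   Unlike isolated_zero, this also counts every point as a zero of the zero function. *)
definition meromorphic_zero :: "(complex \<Rightarrow> complex) \<Rightarrow> complex \<Rightarrow> bool" where
  "meromorphic_zero f s \<longleftrightarrow> f \<midarrow>s\<rightarrow> 0"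

lemma meromorphic_zero_analytic_iff:
  assumes "f analytic_on {s}"
  shows "meromorphic_zero f s \<longleftrightarrow> f s = 0"
proof -
  have "f \<midarrow>s\<rightarrow> f s"
    using analytic_at_imp_isCont[OF assms] by (simp add: isCont_def)
  then show ?thesis
    unfolding meromorphic_zero_def using LIM_unique by metis
qed

lemma zeta2_hat_meromorphic:
  assumes "q > 0"
  shows "zeta2_hat q g \<alpha> \<beta> a h \<gamma> \<delta> meromorphic_on UNIV"
proof -
  have [simp]: "complex_of_real q powr z = exp (z * of_real (ln q))" for z
    using assms by (simp add: powr_def Ln_of_real)
  have *: "(\<lambda>s. exp (u s * of_real (ln q))) meromorphic_on UNIV" if "u analytic_on UNIV" for u
    by (intro analytic_on_imp_meromorphic_on analytic_intros that)
  have "(\<lambda>s. zeta2_hat q g \<alpha> \<beta> a h \<gamma> \<delta> s) meromorphic_on UNIV"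
    unfolding zeta2_hat_def C2_def C1_def Y_def
    by (simp only: \<open>\<And>z. complex_of_real q powr z = exp (z * of_real (ln q))\<close>)
       (intro meromorphic_intros * analytic_intros; simp)
  then show ?thesis by simp
qed

end

theory Submission
  imports Defs
begin

text \<open>
  Put \<open>w = q\<^bsup>-s\<^esup>\<close> and let \<open>A s\<close> be the first summand of the zeta function. As \<open>Y\<close> is invariant under
  \<open>s \<mapsto> 1 - s\<close>, the zeta function is \<open>A s + A (1 - s)\<close>. Writing \<open>A = P / D\<close> with
  \<open>D = (1 - w) (1 - q w) (1 - q w\<^sup>2)\<close>, one has \<open>D (1 - s) = - D s / (q\<^sup>2 w\<^sup>4)\<close>, so that a zero
  of the zeta function is a zero of \<open>P s - q\<^sup>2 w\<^sup>4 P (1 - s)\<close>. For \<open>Re s > 1/2\<close> the first term dominates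
  factor by factor: each comparison reduces to
  \<open>\<bar>q v\<^sup>2 - c v + 1\<bar> < \<bar>v\<^sup>2 - c v + q\<bar>\<close> on the open unit disc, for real \<open>c\<close> with \<open>\<bar>c\<bar> \<le> q + 1\<close>, where
  \<open>v = q\<^bsup>1/2-s\<^esup>\<close> or its square.
\<close>

section \<open>A quadratic inequality on the unit disc\<close>

text \<open>The two quadratics are reciprocal to each other, so the difference of their squared
  norms factors: with \<open>r\<close> = |v|^2, \<open>x\<close> = Re v and c = \<open>d\<close>
  real it is (q - 1)(1 - r)((q + 1)(1 + r) - 2dx). The last factor is positive because |d| \<le> q +
  1 and 2|x| < 1 + r.\<close>

lemma norm_reflected_quadratic_less:
  fixes q :: real and c v :: complex
  assumes q: "q > 1" and c: "c \<in> \<real>" "cmod c \<le> q + 1" and v: "cmod v < 1"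
  shows "cmod (of_real q * v\<^sup>2 - c * v + 1) < cmod (v\<^sup>2 - c * v + of_real q)"
proof -
  obtain d where d: "c = of_real d" using c(1) by (auto elim: Reals_cases)
  have dq: "\<bar>d\<bar> \<le> q + 1" using c(2) d by simp
  define x y where "x = Re v" and "y = Im v"
  define r where "r = x\<^sup>2 + y\<^sup>2"
  have v_eq: "v = Complex x y" by (simp add: x_def y_def)
  have r1: "r < 1"
    using v by (simp add: r_def x_def y_def cmod_def)
  have x1: "\<bar>x\<bar> < 1" using v abs_Re_le_cmod[of v] by (simp add: x_def)
  have "0 < (1 - \<bar>x\<bar>)\<^sup>2" using x1 by simp
  then have "2 * \<bar>x\<bar> < 1 + x\<^sup>2" by (simp add: power2_eq_square algebra_simps)
  also have "\<dots> \<le> 1 + r" by (simp add: r_def)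
  finally have xr: "2 * \<bar>x\<bar> < 1 + r" .
  have "2 * d * x \<le> \<bar>d\<bar> * (2 * \<bar>x\<bar>)"
    by (metis abs_ge_self abs_mult abs_numeral mult.assoc mult.left_commute)
  also have "\<dots> \<le> (q + 1) * (2 * \<bar>x\<bar>)" using dq by (intro mult_right_mono) auto
  also have "\<dots> < (q + 1) * (1 + r)" using xr q by (intro mult_strict_left_mono) auto
  finally have pos: "0 < (q - 1) * (1 - r) * ((q + 1) * (1 + r) - 2 * d * x)"
    using q r1 by (intro mult_pos_pos) auto
  have "(cmod (v\<^sup>2 - c * v + of_real q))\<^sup>2 - (cmod (of_real q * v\<^sup>2 - c * v + 1))\<^sup>2
      = (q - 1) * (1 - r) * ((q + 1) * (1 + r) - 2 * d * x)"
    unfolding cmod_power2 d v_eq r_def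
    by (simp add: power2_eq_square algebra_simps)
  with pos show ?thesis
    by (intro power2_less_imp_less[of "cmod (of_real q * v\<^sup>2 - c * v + 1)"]) auto
qed

section \<open>Powers of q and the functional equation\<close>

lemma powr_of_real_add:
  fixes x y :: complex
  assumes "q > 0"
  shows "of_real q powr (x + y) = of_real q powr x * of_real q powr y"
  using assms by (simp add: powr_def algebra_simps exp_add)

lemma powr_of_real_power:
  fixes x :: complex
  assumes "q > 0"
  shows "(of_real q powr x) ^ n = of_real q powr (of_nat n * x)"
  using assms by (simp add: powr_def exp_of_nat_mult[symmetric] mult.assoc)

lemma powr_one_minus:
  fixes s :: complex
  assumes "q > 0"
  shows "of_real q powr (1 - s) = of_real q * of_real q powr (- s)"
    and "of_real q powr (- (1 - s)) = 1 / (of_real q * of_real q powr (- s))"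
    and "of_real q powr s = 1 / of_real q powr (- s)"
proof -
  show 1: "of_real q powr (1 - s) = of_real q * of_real q powr (- s)"
    using powr_of_real_add[OF assms, of 1 "- s"] assms by simp
  show "of_real q powr (- (1 - s)) = 1 / (of_real q * of_real q powr (- s))"
    unfolding powr_minus[of _ "1 - s"] 1 by (simp add: inverse_eq_divide)
  show "of_real q powr s = 1 / of_real q powr (- s)"
    by (simp add: powr_minus inverse_eq_divide)
qed

text \<open>Reflecting s replaces \<open>w\<close> by 1/(Qw). By \<alpha>\<beta> = q each of the g
  quadratic factors loses a factor Qw^2, the denominator loses one more, and the exponential gains
  (Qw^2)^(g-1), so everything cancels.\<close>

lemma Y_symmetric:
  assumes q: "q > 0" and ab: "\<And>i. i \<in> {1..g} \<Longrightarrow> \<alpha> i * \<beta> i = of_real q"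
  shows "Y q g \<alpha> \<beta> (1 - s) = Y q g \<alpha> \<beta> s"
proof -
  define Q where "Q = complex_of_real q"
  define w where "w = Q powr (- s)"
  define E where "E z = Q powr ((of_nat g - 1) * (z - 1/2))" for z
  define F where "F w = (\<Prod>i=1..g. (1 - \<alpha> i * w) * (1 - \<beta> i * w))" for w
  have nz: "Q \<noteq> 0" "w \<noteq> 0" using q by (auto simp: Q_def w_def)
  have w1: "Q powr (- (1 - s)) = 1 / (Q * w)" "Q powr (1 - s) = Q * w"
    unfolding Q_def w_def by (simp_all only: powr_one_minus(1,2)[OF q])
  have w2: "Q powr (1 - (1 - s)) = 1 / w"
    unfolding Q_def w_def using powr_one_minus(3)[OF q, of s] by simp
  have Qw: "Q * w\<^sup>2 = Q powr (1 - 2 * s)"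
    using powr_of_real_add[OF q, of 1 "2 * - s"] powr_of_real_power[OF q, of "- s" 2] q
    by (simp add: Q_def w_def)
  \<comment> \<open>One extra factor Qw^2 on both sides turns the complex exponent g - 1 into the
    natural power g.\<close>
  have "E (1 - s) * (Q * w\<^sup>2) = E s * (Q * w\<^sup>2) ^ g"
    unfolding Qw E_def powr_of_real_power[OF q, folded Q_def]
      powr_of_real_add[OF q, folded Q_def, symmetric]
    by (rule arg_cong[where f = "(powr) Q"]) (simp add: field_simps)
  moreover have "F (1 / (Q * w)) * (Q * w\<^sup>2) ^ g = F w"
  proof -
    have "(1 - \<alpha> i * (1 / (Q * w))) * (1 - \<beta> i * (1 / (Q * w))) * (Q * w\<^sup>2)
        = (1 - \<alpha> i * w) * (1 - \<beta> i * w)" if "i \<in> {1..g}" for i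
    proof -
      have "(1 - \<alpha> i * (1 / (Q * w))) * (1 - \<beta> i * (1 / (Q * w))) * (Q * w\<^sup>2)
          = Q * w\<^sup>2 - (\<alpha> i + \<beta> i) * w + \<alpha> i * \<beta> i / Q"
        using nz by (simp add: field_simps power2_eq_square)
      also have "\<dots> = (1 - \<alpha> i * w) * (1 - \<beta> i * w)"
        using ab[OF that] nz by (simp add: Q_def algebra_simps power2_eq_square)
      finally show ?thesis .
    qed
    then have "(\<Prod>i=1..g. (1 - \<alpha> i * (1 / (Q * w))) * (1 - \<beta> i * (1 / (Q * w))) * (Q * w\<^sup>2)) = F w"
      unfolding F_def by (intro prod.cong) auto
    then show ?thesis by (simp add: F_def prod.distrib)
  qed
  ultimately have "E (1 - s) * F (1 / (Q * w)) * (Q * w\<^sup>2) = E s * F w"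
    by (metis mult.assoc mult.commute)
  \<comment> \<open>The two denominators differ by a nonzero factor, hence vanish together; where
    they do, both quotients are 0 by x / 0 = 0, so the symmetry holds at every point.\<close>
  moreover have "(1 - 1 / (Q * w)) * (1 - 1 / w) = (1 - w) * (1 - Q * w) / (Q * w\<^sup>2)"
    using nz by (simp add: field_simps power2_eq_square)
  ultimately have "E (1 - s) * F (1 / (Q * w)) / ((1 - 1 / (Q * w)) * (1 - 1 / w))
      = E s * F w / ((1 - w) * (1 - Q * w))"
    by simp
  then show ?thesis
    unfolding Y_def by (fold Q_def) (simp only: w1 w2 flip: w_def E_def F_def)
qed

definition zeta_part ::
  "real \<Rightarrow> nat \<Rightarrow> (nat \<Rightarrow> complex) \<Rightarrow> (nat \<Rightarrow> complex) \<Rightarrow>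
   real \<Rightarrow> nat \<Rightarrow> (nat \<Rightarrow> complex) \<Rightarrow> (nat \<Rightarrow> complex) \<Rightarrow> complex \<Rightarrow> complex" where
  "zeta_part q g \<alpha> \<beta> a h \<gamma> \<delta> s =
     C1 q a h \<gamma> \<delta> s * (Y q g \<alpha> \<beta> (2 * s) / (1 - of_real q powr (1 - s)))"

text \<open>Since 2(1 - s) = 1 - (2s - 1), \<open>Y_symmetric\<close> identifies the two values of
  \<open>Y\<close>, and 1/(1 - q^s) = -q^(-s)/(1 - q^(-s)) turns the minus sign into a plus.\<close>

lemma zeta2_hat_eq_zeta_part:
  assumes q: "q > 0" and ab: "\<And>i. i \<in> {1..g} \<Longrightarrow> \<alpha> i * \<beta> i = of_real q"
  shows "zeta2_hat q g \<alpha> \<beta> a h \<gamma> \<delta> s =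
    zeta_part q g \<alpha> \<beta> a h \<gamma> \<delta> s + zeta_part q g \<alpha> \<beta> a h \<gamma> \<delta> (1 - s)"
proof -
  have "Y q g \<alpha> \<beta> (2 * (1 - s)) = Y q g \<alpha> \<beta> (2 * s - 1)"
    using Y_symmetric[OF q ab, where s = "2 * s - 1"] by (simp add: algebra_simps)
  moreover have "y / (1 - of_real q powr (1 - (1 - s)))
      = - (of_real q powr (- s) * y / (1 - of_real q powr (- s)))" for y :: complex
  proof -
    define w where "w = complex_of_real q powr (- s)"
    have "w \<noteq> 0" using q by (simp add: w_def)
    then have "y / (1 - 1 / w) = - (w * y / (1 - w))"
      \<comment> \<open>At \<open>w = 1\<close> both sides are 0 by division by zero.\<close>
      by (cases "w = 1") (auto simp: field_simps)
    then show ?thesis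
      using powr_one_minus(3)[OF q, of s] by (simp add: w_def)
  qed
  ultimately show ?thesis
    by (simp add: zeta2_hat_def zeta_part_def C2_def)
qed

section \<open>Clearing denominators\<close>

text \<open>\<open>numer\<close> and \<open>denom\<close> are P and D of the overview. The factor 1
  + w of \<open>C1\<close> is already cancelled against 1 - w^2 = (1 + w)(1 - w), which comes from
  the denominator of Y(2s).\<close>

definition numer ::
  "real \<Rightarrow> nat \<Rightarrow> (nat \<Rightarrow> complex) \<Rightarrow> (nat \<Rightarrow> complex) \<Rightarrow>
   real \<Rightarrow> nat \<Rightarrow> (nat \<Rightarrow> complex) \<Rightarrow> (nat \<Rightarrow> complex) \<Rightarrow> complex \<Rightarrow> complex" where
  "numer q g \<alpha> \<beta> a h \<gamma> \<delta> s =
     of_real q powr (of_real a * s) * of_real q powr (- of_nat h * s) *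
     (\<Prod>j=1..h. (1 - \<gamma> j * of_real q powr (s - 1/2)) * (1 - \<delta> j * of_real q powr (s - 1/2))) *
     of_real q powr ((of_nat g - 1) * (2 * s - 1/2)) *
     (\<Prod>i=1..g. (1 - \<alpha> i * of_real q powr (- (2 * s))) * (1 - \<beta> i * of_real q powr (- (2 * s))))"

definition denom :: "real \<Rightarrow> complex \<Rightarrow> complex" where
  "denom q s = (1 - of_real q powr (- s)) * (1 - of_real q * of_real q powr (- s)) *
     (1 - of_real q * (of_real q powr (- s))\<^sup>2)"

text \<open>The hypothesis excludes w = -1, where the cancelled factor vanishes and the pointwise
  value of \<open>zeta_part\<close> is 0.\<close>

lemma zeta_part_eq:
  assumes q: "q > 0" and w: "of_real q powr (- s) \<noteq> -1"
  shows "zeta_part q g \<alpha> \<beta> a h \<gamma> \<delta> s = numer q g \<alpha> \<beta> a h \<gamma> \<delta> s / denom q s"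
proof -
  define w where "w = complex_of_real q powr (- s)"
  have w2: "complex_of_real q powr (- (2 * s)) = w\<^sup>2"
    using powr_of_real_power[OF q, of "- s" 2] by (simp add: w_def)
  have *: "complex_of_real q powr (1 - 2 * s) = of_real q * w\<^sup>2"
    "complex_of_real q powr (1 - s) = of_real q * w"
    unfolding powr_one_minus(1)[OF q] w2 by (simp_all add: w_def)
  have "1 + w \<noteq> 0" using w by (simp add: w_def add_eq_0_iff)
  moreover have "1 - w\<^sup>2 = (1 + w) * (1 - w)" by (simp add: algebra_simps power2_eq_square)
  ultimately show ?thesis
    unfolding zeta_part_def C1_def Y_def numer_def denom_def
    by (fold w_def) (simp only: * w2, simp add: mult_ac)
qed

text \<open>Under w -> 1/(qw) the first two factors are exchanged and the third is kept, each up to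
  a monomial with sign -1; the three signs leave a minus.\<close>

lemma denom_symmetric:
  assumes q: "q > 0"
  shows "(of_real q)\<^sup>2 * (of_real q powr (- s)) ^ 4 * denom q (1 - s) = - denom q s"
proof -
  define Q where "Q = complex_of_real q"
  define w where "w = Q powr (- s)"
  have nz: "Q \<noteq> 0" "w \<noteq> 0" using q by (auto simp: Q_def w_def)
  have w': "Q powr (- (1 - s)) = 1 / (Q * w)"
    unfolding Q_def w_def by (rule powr_one_minus(2)[OF q])
  show ?thesis
    unfolding denom_def using nz
    by (fold Q_def, simp only: w', fold w_def)
      (simp add: field_simps power2_eq_square eval_nat_numeral)
qed

text \<open>The zeta function times \<open>denom\<close>; the minus sign is that of
  \<open>denom_symmetric\<close>. No division remains, so the function is continuous and its values
  can be used where those of \<open>zeta2_hat\<close> are artefacts.\<close>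

definition reduced_zeta ::
  "real \<Rightarrow> nat \<Rightarrow> (nat \<Rightarrow> complex) \<Rightarrow> (nat \<Rightarrow> complex) \<Rightarrow>
   real \<Rightarrow> nat \<Rightarrow> (nat \<Rightarrow> complex) \<Rightarrow> (nat \<Rightarrow> complex) \<Rightarrow> complex \<Rightarrow> complex" where
  "reduced_zeta q g \<alpha> \<beta> a h \<gamma> \<delta> s = numer q g \<alpha> \<beta> a h \<gamma> \<delta> s -
     (of_real q)\<^sup>2 * (of_real q powr (- s)) ^ 4 * numer q g \<alpha> \<beta> a h \<gamma> \<delta> (1 - s)"

lemma zeta2_hat_mult_denom:
  assumes q: "q > 0" and ab: "\<And>i. i \<in> {1..g} \<Longrightarrow> \<alpha> i * \<beta> i = of_real q"
    and "of_real q powr (- s) \<noteq> -1" "of_real q powr (- (1 - s)) \<noteq> -1" "denom q s \<noteq> 0"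
  shows "zeta2_hat q g \<alpha> \<beta> a h \<gamma> \<delta> s * denom q s = reduced_zeta q g \<alpha> \<beta> a h \<gamma> \<delta> s"
proof -
  define k where "k = (complex_of_real q)\<^sup>2 * (complex_of_real q powr (- s)) ^ 4"
  have k: "k \<noteq> 0" using q by (simp add: k_def)
  have "k * denom q (1 - s) = - denom q s"
    using denom_symmetric[OF q, of s] by (simp add: k_def)
  then have D: "denom q (1 - s) = - denom q s / k" using k by (simp add: field_simps)
  have "zeta2_hat q g \<alpha> \<beta> a h \<gamma> \<delta> s * denom q s
     = (numer q g \<alpha> \<beta> a h \<gamma> \<delta> s / denom q s
        + numer q g \<alpha> \<beta> a h \<gamma> \<delta> (1 - s) / denom q (1 - s)) * denom q s"
    using zeta2_hat_eq_zeta_part[OF q ab] zeta_part_eq[OF q] assms(3,4) by simp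
  also have "\<dots> = numer q g \<alpha> \<beta> a h \<gamma> \<delta> s - k * numer q g \<alpha> \<beta> a h \<gamma> \<delta> (1 - s)"
    unfolding D using k assms(5) by (simp add: field_simps)
  finally show ?thesis by (simp add: reduced_zeta_def k_def)
qed

text \<open>The multiplier k(s) = q^2 w^4 satisfies k(s) k(1 - s) = 1, so the reflection exchanges
  the two terms up to the factor -k(s).\<close>

lemma reduced_zeta_symmetric:
  assumes q: "q > 0"
  shows "reduced_zeta q g \<alpha> \<beta> a h \<gamma> \<delta> s =
    - ((of_real q)\<^sup>2 * (of_real q powr (- s)) ^ 4) * reduced_zeta q g \<alpha> \<beta> a h \<gamma> \<delta> (1 - s)"
proof -
  define Q where "Q = complex_of_real q"
  define w where "w = Q powr (- s)"
  have nz: "Q \<noteq> 0" "w \<noteq> 0" using q by (auto simp: Q_def w_def)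
  have w': "Q powr (- (1 - s)) = 1 / (Q * w)"
    unfolding Q_def w_def by (rule powr_one_minus(2)[OF q])
  have "Q\<^sup>2 * w ^ 4 * (Q\<^sup>2 * (1 / (Q * w)) ^ 4) = 1"
    using nz by (simp add: field_simps eval_nat_numeral)
  then have "x - Q\<^sup>2 * w ^ 4 * y = - (Q\<^sup>2 * w ^ 4) * (y - Q\<^sup>2 * (1 / (Q * w)) ^ 4 * x)" for x y
    by (simp add: right_diff_distrib flip: mult.assoc)
  then show ?thesis
    unfolding reduced_zeta_def by (fold Q_def) (simp only: w' diff_diff_eq2 add_diff_cancel_left' flip: w_def)
qed

section \<open>From zeros as limits to zeros of the reduced function\<close>

lemma isCont_reduced_zeta:
  assumes "q > 0"
  shows "isCont (reduced_zeta q g \<alpha> \<beta> a h \<gamma> \<delta>) s"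
proof -
  have eq: "complex_of_real q powr z = exp (z * of_real (ln q))" for z
    using assms by (simp add: powr_def Ln_of_real)
  have cont: "isCont (numer q g \<alpha> \<beta> a h \<gamma> \<delta>) s" for s
    unfolding numer_def[abs_def] eq by (intro continuous_intros)
  have "isCont (\<lambda>s. numer q g \<alpha> \<beta> a h \<gamma> \<delta> (1 - s)) s"
    by (rule isCont_o2[where f = "\<lambda>s. 1 - s", OF _ cont]) (intro continuous_intros)
  with cont[of s] show ?thesis
    unfolding reduced_zeta_def[abs_def] eq by (intro continuous_intros)
qed

text \<open>Allows finitely many exceptional values of q^(-z) to be avoided in a punctured
  neighbourhood of any point.\<close>

lemma eventually_powr_neq:
  assumes "q > 1"
  shows "\<forall>\<^sub>F z in at s. complex_of_real q powr (- z) \<noteq> c"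
proof -
  define L where "L = complex_of_real (ln q)"
  have L: "L \<noteq> 0" using assms by (simp add: L_def)
  have eq: "complex_of_real q powr (- z) = exp (- z * L)" for z
    using assms by (simp add: powr_def L_def Ln_of_real)
  show ?thesis
  proof (cases "exp (- s * L) = c")
    case True
    \<comment> \<open>The radius pi is chosen because exp is injective on every ball of that
      radius.\<close>
    have "((\<lambda>z. (- z * L)) \<longlongrightarrow> - s * L) (at s)" by (intro tendsto_intros)
    then have "\<forall>\<^sub>F z in at s. dist (- z * L) (- s * L) < pi"
      by (rule tendstoD) (rule pi_gt_zero)
    moreover have "\<forall>\<^sub>F z in at s. z \<noteq> s" by (rule eventually_neq_at_within)
    ultimately show ?thesis
    proof eventually_elim
      case (elim z)
      have "- z * L \<in> ball (- s * L) pi" using elim(1) by (simp add: dist_commute)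
      moreover have "- s * L \<in> ball (- s * L) pi" by simp
      ultimately show ?case
        using inj_onD[OF inj_on_exp_pi[of "- s * L"], of "- z * L" "- s * L"] elim(2) L True
        by (auto simp: eq)
    qed
  next
    case False
    have "((\<lambda>z. exp (- z * L)) \<longlongrightarrow> exp (- s * L)) (at s)" by (intro tendsto_intros)
    then show ?thesis unfolding eq by (rule tendsto_imp_eventually_ne) (rule False)
  qed
qed

text \<open>On a punctured neighbourhood the product with \<open>denom\<close> is
  \<open>reduced_zeta\<close>. \<open>denom\<close> has a finite limit at s, so the product tends to
  0, and continuity gives the value at s itself.\<close>

lemma meromorphic_zero_imp_reduced_zeta_eq_0:
  assumes q: "q > 1" and ab: "\<And>i. i \<in> {1..g} \<Longrightarrow> \<alpha> i * \<beta> i = of_real q"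
    and z: "meromorphic_zero (zeta2_hat q g \<alpha> \<beta> a h \<gamma> \<delta>) s"
  shows "reduced_zeta q g \<alpha> \<beta> a h \<gamma> \<delta> s = 0"
proof -
  have q0: "q > 0" using q by simp
  define Q where "Q = complex_of_real q"
  define R where "R = complex_of_real (sqrt q)"
  have nz: "Q \<noteq> 0" "R \<noteq> 0" using q by (auto simp: Q_def R_def)
  have RQ: "R\<^sup>2 = Q" using q by (simp add: Q_def R_def flip: of_real_power)
  note ev = eventually_powr_neq[OF q, where s = s, folded Q_def]
  \<comment> \<open>The values 1, 1/Q and 1/R, -1/R are the zeros of \<open>denom\<close> in w; at
    -1 and -1/Q the cancellation of 1 + w fails for z and for 1 - z respectively.\<close>
  have "\<forall>\<^sub>F z in at s. zeta2_hat q g \<alpha> \<beta> a h \<gamma> \<delta> z * denom q z = reduced_zeta q g \<alpha> \<beta> a h \<gamma> \<delta> z"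
    using ev[where c = 1] ev[where c = "-1"] ev[where c = "1 / Q"] ev[where c = "- (1 / Q)"]
      ev[where c = "1 / R"] ev[where c = "- (1 / R)"]
  proof eventually_elim
    case (elim z)
    define w where "w = Q powr (- z)"
    have w0: "w \<noteq> 0" using nz by (simp add: w_def)
    have e: "w \<noteq> 1" "w \<noteq> -1" "w \<noteq> 1 / Q" "w \<noteq> - (1 / Q)" "w \<noteq> 1 / R" "w \<noteq> - (1 / R)"
      using elim by (auto simp: w_def)
    have "1 / (Q * w) \<noteq> -1" using e(4) nz w0 by (auto simp: field_simps minus_equation_iff)
    then have 1: "Q powr (- (1 - z)) \<noteq> -1"
      unfolding Q_def w_def powr_one_minus(2)[OF q0] .
    have "1 - R * w \<noteq> 0" "1 + R * w \<noteq> 0"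
      using e(5,6) nz by (auto simp: field_simps add_eq_0_iff)
    moreover have "1 - Q * w\<^sup>2 = (1 - R * w) * (1 + R * w)"
      unfolding RQ[symmetric] by (simp add: algebra_simps power2_eq_square)
    ultimately have "1 - Q * w\<^sup>2 \<noteq> 0" by simp
    then have 2: "denom q z \<noteq> 0"
      unfolding denom_def using e(1,3) nz
      by (fold Q_def, fold w_def) (simp add: nonzero_eq_divide_eq mult.commute)
    show ?case
      using zeta2_hat_mult_denom[OF q0 ab _ _ 2] 1 e(2) by (simp add: w_def Q_def)
  qed
  moreover have "isCont (denom q) s"
    unfolding denom_def[abs_def] using q0 by (simp add: powr_def continuous_intros)
  then have "((\<lambda>z. zeta2_hat q g \<alpha> \<beta> a h \<gamma> \<delta> z * denom q z) \<longlongrightarrow> 0 * denom q s) (at s)"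
    using z unfolding meromorphic_zero_def isCont_def by (intro tendsto_mult)
  ultimately have "(reduced_zeta q g \<alpha> \<beta> a h \<gamma> \<delta> \<longlongrightarrow> 0) (at s)"
    using tendsto_cong by fastforce
  then show ?thesis
    using isCont_reduced_zeta[OF q0, where s = s] LIM_unique
    unfolding isCont_def by blast
qed

section \<open>Norm comparison to the right of the critical line\<close>

text \<open>Expanding with cd = q gives exactly the two quadratics of
  \<open>norm_reflected_quadratic_less\<close>. It serves the \<gamma>, \<delta> factors, with v =
  q^(1/2-s) and the factor at s on the right.\<close>

lemma norm_reflected_factor_less:
  fixes v c d :: complex
  assumes q: "q > 1" and cd: "c * d = of_real q" "c + d \<in> \<real>" "cmod (c + d) \<le> q + 1"
    and v: "v \<noteq> 0" "cmod v < 1"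
  shows "cmod ((1 - c * v) * (1 - d * v)) < cmod (v\<^sup>2 * ((1 - c * (1 / v)) * (1 - d * (1 / v))))"
proof -
  have "(1 - c * v) * (1 - d * v) = of_real q * v\<^sup>2 - (c + d) * v + 1"
    by (simp add: algebra_simps power2_eq_square flip: cd(1))
  moreover have "v\<^sup>2 * ((1 - c * (1 / v)) * (1 - d * (1 / v))) = v\<^sup>2 - (c + d) * v + of_real q"
    using v by (simp add: field_simps power2_eq_square flip: cd(1))
  ultimately show ?thesis
    using norm_reflected_quadratic_less[OF q cd(2,3) v(2)] by simp
qed

text \<open>Both sides are the same two quadratics in u, divided by q. It serves the \<alpha>,
  \<beta> factors, where u = q^(1-2s), so that q^(-2s) = u/q and its reflection is 1/(qu).\<close>

lemma norm_reflected_square_factor_less: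
  fixes u c d :: complex
  assumes q: "q > 1" and cd: "c * d = of_real q" "c + d \<in> \<real>" "cmod (c + d) \<le> q + 1"
    and u: "u \<noteq> 0" "cmod u < 1"
  shows "cmod (u\<^sup>2 * ((1 - c * (1 / (of_real q * u))) * (1 - d * (1 / (of_real q * u)))))
    < cmod ((1 - c * (u / of_real q)) * (1 - d * (u / of_real q)))"
proof -
  have q0: "complex_of_real q \<noteq> 0" using q by simp
  have "u\<^sup>2 * ((1 - c * (1 / (of_real q * u))) * (1 - d * (1 / (of_real q * u))))
      = u\<^sup>2 - (c + d) / of_real q * u + c * d / (of_real q)\<^sup>2"
    using u q0 by (simp add: field_simps power2_eq_square)
  also have "\<dots> = (of_real q * u\<^sup>2 - (c + d) * u + 1) / of_real q"
    using q0 by (simp add: cd(1) field_simps power2_eq_square)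
  finally have 1: "cmod (u\<^sup>2 * ((1 - c * (1 / (of_real q * u))) * (1 - d * (1 / (of_real q * u)))))
     = cmod (of_real q * u\<^sup>2 - (c + d) * u + 1) / q"
    using q by (simp add: norm_divide)
  have "(1 - c * (u / of_real q)) * (1 - d * (u / of_real q))
      = 1 - (c + d) / of_real q * u + c * d / (of_real q)\<^sup>2 * u\<^sup>2"
    using q0 by (simp add: field_simps power2_eq_square)
  also have "\<dots> = (u\<^sup>2 - (c + d) * u + of_real q) / of_real q"
    using q0 by (simp add: cd(1) field_simps power2_eq_square)
  finally have 2: "cmod ((1 - c * (u / of_real q)) * (1 - d * (u / of_real q)))
     = cmod (u\<^sup>2 - (c + d) * u + of_real q) / q"
    using q by (simp add: norm_divide)
  show ?thesis
    unfolding 1 2 using norm_reflected_quadratic_less[OF q cd(2,3) u(2)] q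
    by (intro divide_strict_right_mono) auto
qed

text \<open>The numerator splits into three groups. The power with exponent \<open>a\<close> and the
  \<gamma>, \<delta> group compare weakly (\<open>a\<close> or \<open>h\<close> may be 0);
  strictness comes from the \<alpha>, \<beta> group, nonempty since g \<ge> 1.\<close>

lemma norm_numer_reflected_less:
  fixes q a :: real and g h :: nat and \<alpha> \<beta> \<gamma> \<delta> :: "nat \<Rightarrow> complex"
  assumes q: "q > 1" and g: "g \<ge> 1" and a: "a \<ge> 0"
    and ab: "\<And>i. i \<in> {1..g} \<Longrightarrow> \<alpha> i * \<beta> i = of_real q"
      "\<And>i. i \<in> {1..g} \<Longrightarrow> \<alpha> i + \<beta> i \<in> \<real>"
      "\<And>i. i \<in> {1..g} \<Longrightarrow> cmod (\<alpha> i + \<beta> i) \<le> q + 1"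
    and cd: "\<And>j. j \<in> {1..h} \<Longrightarrow> \<gamma> j * \<delta> j = of_real q"
      "\<And>j. j \<in> {1..h} \<Longrightarrow> \<gamma> j + \<delta> j \<in> \<real>"
      "\<And>j. j \<in> {1..h} \<Longrightarrow> cmod (\<gamma> j + \<delta> j) \<le> q + 1"
    and s: "Re s > 1/2"
  shows "cmod ((of_real q)\<^sup>2 * (of_real q powr (- s)) ^ 4 * numer q g \<alpha> \<beta> a h \<gamma> \<delta> (1 - s))
    < cmod (numer q g \<alpha> \<beta> a h \<gamma> \<delta> s)"
proof -
  have q0: "q > 0" using q by simp
  define Q where "Q = complex_of_real q"
  define v where "v = Q powr (1/2 - s)"
  define u where "u = v\<^sup>2"
  define G where "G w = (\<Prod>j=1..h. (1 - \<gamma> j * w) * (1 - \<delta> j * w))" for w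
  define F where "F w = (\<Prod>i=1..g. (1 - \<alpha> i * w) * (1 - \<beta> i * w))" for w
  have Q0: "Q \<noteq> 0" using q by (simp add: Q_def)
  have normQ: "cmod (Q powr z) = q powr Re z" for z
    unfolding Q_def using q by (simp add: powr_def Ln_of_real)
  have v0: "v \<noteq> 0" "u \<noteq> 0" using Q0 by (auto simp: v_def u_def)
  have v1: "cmod v < 1" using q s by (simp add: v_def normQ powr_less_one)
  have u1: "cmod u < 1" using v1 by (simp add: u_def norm_power power_Suc_less_one abs_square_less_1)
  note padd = powr_of_real_add[OF q0, folded Q_def]
    and ppow = powr_of_real_power[OF q0, folded Q_def]
  have vs: "Q powr (1 - s - 1/2) = v" "Q powr (s - 1/2) = 1 / v"
    using powr_minus[of Q "1/2 - s"] by (simp_all add: v_def inverse_eq_divide)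
  have u_eq: "u = Q powr (1 - 2 * s)"
    unfolding u_def v_def ppow by (simp add: algebra_simps)
  have us: "Q powr (- (2 * s)) = u / Q" "Q powr (- (2 * (1 - s))) = 1 / (Q * u)"
  proof -
    have "Q * Q powr (- (2 * s)) = u"
      unfolding u_eq Q_def by (rule powr_one_minus(1)[OF q0, symmetric])
    then show 1: "Q powr (- (2 * s)) = u / Q" using Q0 by (simp add: field_simps)
    have "Q powr (- (2 * (1 - s))) * (Q powr 1 * u) = Q powr 0"
      unfolding u_eq padd[symmetric] by (simp add: algebra_simps)
    then show "Q powr (- (2 * (1 - s))) = 1 / (Q * u)"
      using Q0 v0 by (simp add: field_simps)
  qed
  have k: "Q\<^sup>2 * (Q powr (- s)) ^ 4 = u\<^sup>2"
  proof -
    have "Q\<^sup>2 * (Q powr (- s)) ^ 4 = (Q * (Q powr (- s))\<^sup>2)\<^sup>2"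
      by (simp add: power_mult_distrib flip: power_mult)
    also have "Q * (Q powr (- s))\<^sup>2 = u"
      using us(1) Q0 unfolding ppow by simp
    finally show ?thesis .
  qed
  have A: "cmod (Q powr (of_real a * (1 - s))) \<le> cmod (Q powr (of_real a * s))"
    unfolding normQ using a q s by (auto intro!: powr_mono mult_left_mono)
  \<comment> \<open>Each of the h factors needs a weight v^2 = q^(1-2s); reflecting the exponential
    q^(-hs) supplies exactly these h weights.\<close>
  have H: "cmod (Q powr (- of_nat h * (1 - s)) * G v) \<le> cmod (Q powr (- of_nat h * s) * G (1 / v))"
  proof -
    have "cmod (G v) \<le> (\<Prod>j=1..h. cmod (v\<^sup>2 * ((1 - \<gamma> j * (1 / v)) * (1 - \<delta> j * (1 / v)))))"
      unfolding G_def prod_norm[symmetric]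
      by (intro prod_mono conjI norm_ge_zero less_imp_le norm_reflected_factor_less[OF q] cd v0 v1)
    also have "\<dots> = cmod ((v\<^sup>2) ^ h * G (1 / v))"
      by (simp add: G_def norm_mult prod_norm[symmetric] prod.distrib norm_power)
    finally have "cmod (Q powr (- of_nat h * (1 - s)) * G v)
      \<le> cmod (Q powr (- of_nat h * (1 - s)) * (v\<^sup>2) ^ h * G (1 / v))"
      unfolding mult.assoc norm_mult[of "Q powr _"] by (rule mult_left_mono) simp
    also have "Q powr (- of_nat h * (1 - s)) * (v\<^sup>2) ^ h = Q powr (- of_nat h * s)"
      unfolding u_def[symmetric] u_eq ppow padd[symmetric]
      by (rule arg_cong[where f = "(powr) Q"]) (simp add: algebra_simps)
    finally show ?thesis .
  qed
  \<comment> \<open>Each of the g factors needs a weight u^2. Reflecting the exponential supplies g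
    - 1 of them, and the multiplier q^2 w^4 = u^2 supplies the last.\<close>
  have F: "cmod (u\<^sup>2 * Q powr ((of_nat g - 1) * (2 * (1 - s) - 1/2)) * F (1 / (Q * u)))
      < cmod (Q powr ((of_nat g - 1) * (2 * s - 1/2)) * F (u / Q))"
  proof -
    have "cmod ((u\<^sup>2) ^ g * F (1 / (Q * u)))
        = (\<Prod>i=1..g. cmod (u\<^sup>2 * ((1 - \<alpha> i * (1 / (Q * u))) * (1 - \<beta> i * (1 / (Q * u))))))"
      by (simp add: F_def norm_mult prod_norm[symmetric] prod.distrib norm_power)
    also have "\<dots> < (\<Prod>i=1..g. cmod ((1 - \<alpha> i * (u / Q)) * (1 - \<beta> i * (u / Q))))"
      unfolding Q_def
    proof (rule prod_mono_strict[where i = 1])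
      have *: "cmod (u\<^sup>2 * ((1 - \<alpha> i * (1 / (of_real q * u))) * (1 - \<beta> i * (1 / (of_real q * u)))))
          < cmod ((1 - \<alpha> i * (u / of_real q)) * (1 - \<beta> i * (u / of_real q)))"
        if "i \<in> {1..g}" for i
        using norm_reflected_square_factor_less[OF q ab[OF that] v0(2) u1] .
      show 1: "1 \<in> {1..g}" using g by simp
      show "cmod (u\<^sup>2 * ((1 - \<alpha> 1 * (1 / (of_real q * u))) * (1 - \<beta> 1 * (1 / (of_real q * u)))))
          < cmod ((1 - \<alpha> 1 * (u / of_real q)) * (1 - \<beta> 1 * (u / of_real q)))"
        by (rule *[OF 1])
      fix i assume i: "i \<in> {1..g}"
      show "0 \<le> cmod (u\<^sup>2 * ((1 - \<alpha> i * (1 / (of_real q * u))) * (1 - \<beta> i * (1 / (of_real q * u)))))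
        \<and> cmod (u\<^sup>2 * ((1 - \<alpha> i * (1 / (of_real q * u))) * (1 - \<beta> i * (1 / (of_real q * u)))))
          \<le> cmod ((1 - \<alpha> i * (u / of_real q)) * (1 - \<beta> i * (u / of_real q)))"
        using *[OF i] by simp
      show "0 < cmod ((1 - \<alpha> i * (u / of_real q)) * (1 - \<beta> i * (u / of_real q)))"
        using *[OF i] norm_ge_zero by (rule le_less_trans[rotated])
    qed simp
    also have "\<dots> = cmod (F (u / Q))" by (simp add: F_def prod_norm)
    finally have "cmod (Q powr ((of_nat g - 1) * (2 * s - 1/2)) * (u\<^sup>2) ^ g * F (1 / (Q * u)))
      < cmod (Q powr ((of_nat g - 1) * (2 * s - 1/2)) * F (u / Q))"
      using Q0 by (simp add: norm_mult)
    moreover have "u\<^sup>2 * Q powr ((of_nat g - 1) * (2 * (1 - s) - 1/2))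
        = Q powr ((of_nat g - 1) * (2 * s - 1/2)) * (u\<^sup>2) ^ g"
      unfolding u_eq ppow padd[symmetric]
      by (rule arg_cong[where f = "(powr) Q"]) (simp add: field_simps)
    ultimately show ?thesis by simp
  qed
  \<comment> \<open>A strict upper bound of a norm is positive. Nonvanishing of the \<gamma>,
    \<delta> product keeps the inequality strict when the groups are multiplied.\<close>
  have "(1 - \<gamma> j * (1 / v)) * (1 - \<delta> j * (1 / v)) \<noteq> 0" if "j \<in> {1..h}" for j
    using norm_reflected_factor_less[OF q cd[OF that] v0(1) v1] by force
  then have G0: "G (1 / v) \<noteq> 0" by (simp add: G_def)
  have less: "cmod (k' * (x' * y' * z')) < cmod (x * y * z)"
    if "cmod x' \<le> cmod x" "cmod y' \<le> cmod y" "cmod (k' * z') < cmod z" "x \<noteq> 0" "y \<noteq> 0"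
    for k' x' y' z' x y z :: complex
  proof -
    have "cmod (k' * (x' * y' * z')) = cmod x' * cmod y' * cmod (k' * z')"
      by (simp add: norm_mult)
    also have "\<dots> \<le> cmod x * cmod y * cmod (k' * z')"
      using that by (intro mult_right_mono mult_mono) auto
    also have "\<dots> < cmod x * cmod y * cmod z"
      using that by (intro mult_strict_left_mono mult_pos_pos) auto
    finally show ?thesis by (simp add: norm_mult)
  qed
  show ?thesis
    using less[OF A H F[unfolded mult.assoc]] Q0 G0
    unfolding numer_def
    by (fold Q_def) (simp only: vs us k mult.assoc F_def[symmetric] G_def[symmetric], simp add: mult.assoc)
qed

theorem theorem3:
  fixes q a :: real and g h :: nat and \<alpha> \<beta> \<gamma> \<delta> :: "nat \<Rightarrow> complex"
  assumes "q > 1" and "g \<ge> 1" and "a \<ge> 0"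
    and "\<And>i. i \<in> {1..g} \<Longrightarrow> \<alpha> i * \<beta> i = of_real q"
    and "\<And>i. i \<in> {1..g} \<Longrightarrow> \<alpha> i + \<beta> i \<in> \<real>"
    and "\<And>i. i \<in> {1..g} \<Longrightarrow> cmod (\<alpha> i + \<beta> i) \<le> q + 1"
    and "\<And>j. j \<in> {1..h} \<Longrightarrow> \<gamma> j * \<delta> j = of_real q"
    and "\<And>j. j \<in> {1..h} \<Longrightarrow> \<gamma> j + \<delta> j \<in> \<real>"
    and "\<And>j. j \<in> {1..h} \<Longrightarrow> cmod (\<gamma> j + \<delta> j) \<le> q + 1"
  shows "\<forall>s. meromorphic_zero (zeta2_hat q g \<alpha> \<beta> a h \<gamma> \<delta>) s \<longrightarrow> Re s = 1/2"
proof (intro allI impI)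
  fix s
  assume z: "meromorphic_zero (zeta2_hat q g \<alpha> \<beta> a h \<gamma> \<delta>) s"
  have "q > 0" using assms(1) by simp
  have nz: "reduced_zeta q g \<alpha> \<beta> a h \<gamma> \<delta> z \<noteq> 0" if "Re z > 1/2" for z
    using norm_numer_reflected_less[of q g a \<alpha> \<beta> h \<gamma> \<delta>, OF assms that]
    unfolding reduced_zeta_def by auto
  have 0: "reduced_zeta q g \<alpha> \<beta> a h \<gamma> \<delta> s = 0"
    using assms(1,4) z by (rule meromorphic_zero_imp_reduced_zeta_eq_0)
  \<comment> \<open>A zero to the left of the line would reflect to one on the right, where the
    strict norm comparison forbids it.\<close>
  then have "reduced_zeta q g \<alpha> \<beta> a h \<gamma> \<delta> (1 - s) = 0"
    using reduced_zeta_symmetric[OF \<open>q > 0\<close>, where s = s] \<open>q > 0\<close> by simp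
  then have "\<not> Re (1 - s) > 1/2" and "\<not> Re s > 1/2" using nz 0 by blast+
  then show "Re s = 1/2" by simp
qed

end
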